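(* Let $f : \mathcal{A}^{\mathbb{Z}} \to \mathcal{A}^{\mathbb{Z}}$ be a one-dimensional cellular automaton over a finite alphabet $\mathcal{A}$ that has equicontinuity points (i.e. at least one equicontinuity point). Then the language $\mathcal{L}(\widetilde\omega(f)) \subset \mathcal{A}^*$ of its generic limit set $\widetilde\omega(f)$ is a $\Sigma^0_1$ set.
   Context: $\mathcal{A}^{\mathbb{Z}}$ carries the product of the discrete topologies, induced by the metric $d(x,y) = \inf\{2^{-n} \mid x_{[-n,n]} = y_{[-n,n]}\}$ (with any fixed value greater than $1$, say $2$, if $x_0 \neq y_0$). A (one-dimensional) cellular automaton is a map $f : \mathcal{A}^{\mathbb{Z}} \to \mathcal{A}^{\mathbb{Z}}$ of the form $f(x)_i = F(x_{i-r},\dots,x_{i+r})$ for some $r \in \mathbb{N}$ and $F : \mathcal{A}^{2r+1} \to \mathcal{A}$. A point $x$ is an equicontinuity point of $f$ if for all $\epsilon > 0$ there is $\delta > 0$ such that for all $y \in \mathcal{A}^{\mathbb{Z}}$, $d(x,y) < \delta$ implies $d(f^n(x), f^n(y)) < \epsilon$ for all $n \in \mathbb{N}$. A set is meager if it is a countable union of sets whose closures have empty interior, and comeager if its complement is meager. For $x \in \mathcal{A}^{\mathbb{Z}}$ let $\omega(x) = \bigcap_{N \in \mathbb{N}} \overline{\{f^n(x) \mid n \ge N\}}$, and for a closed set $K$ let $\mathcal{D}(K) = \{x \mid \omega(x) \subset K\}$. $K$ is a generic attractor if $\mathcal{D}(K)$ is comeager. The generic limit set $\widetilde\omega(f)$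 is the intersection of all generic attractors; it is the smallest generic attractor, and it is a nonempty closed shift-invariant set. The language $\mathcal{L}(X)$ of $X \subset \mathcal{A}^{\mathbb{Z}}$ is the set of all finite words occurring as subwords of configurations in $X$. $\Sigma^0_1$ refers to the arithmetical hierarchy for subsets of $\mathcal{A}^*$ (under a standard computable coding). *)

theory Defs
  imports "HOL-Analysis.Analysis" "HOL-Library.Nat_Bijection"
begin

section \<open>Configurations and cellular automata\<close>

definition config_topology :: "(int \<Rightarrow> 'a) topology" where
  "config_topology = product_topology (\<lambda>_. discrete_topology UNIV) UNIV"

text \<open>The metric inducing \<^const>\<open>config_topology\<close>.  The case distinction is needed because the
  infimum would otherwise range over the empty set.\<close>

definition config_dist :: "(int \<Rightarrow> 'a) \<Rightarrow> (int \<Rightarrow> 'a) \<Rightarrow> real" where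
  "config_dist x y =
     (if x 0 \<noteq> y 0 then 2
      else Inf {(1/2) ^ n | n :: nat. \<forall>i \<in> {- int n..int n}. x i = y i})"

text \<open>The local rule \<open>F\<close> is only ever applied to words of length \<open>2 * r + 1\<close>.\<close>

definition cellular_automaton :: "((int \<Rightarrow> 'a) \<Rightarrow> (int \<Rightarrow> 'a)) \<Rightarrow> bool" where
  "cellular_automaton f \<longleftrightarrow>
     (\<exists>(r :: nat) (F :: 'a list \<Rightarrow> 'a). \<forall>x i. f x i = F (map x [i - int r..i + int r]))"

definition equicontinuity_point ::
    "((int \<Rightarrow> 'a) \<Rightarrow> (int \<Rightarrow> 'a)) \<Rightarrow> (int \<Rightarrow> 'a) \<Rightarrow> bool" where
  "equicontinuity_point f x \<longleftrightarrow>
     (\<forall>\<epsilon>>0. \<exists>\<delta>>0. \<forall>y. config_dist x y < \<delta> \<longrightarrow>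
        (\<forall>n. config_dist ((f ^^ n) x) ((f ^^ n) y) < \<epsilon>))"

section \<open>The generic limit set\<close>

definition meager :: "'b topology \<Rightarrow> 'b set \<Rightarrow> bool" where
  "meager T S \<longleftrightarrow>
     (\<exists>\<N>. countable \<N> \<and>
          (\<forall>N \<in> \<N>. N \<subseteq> topspace T \<and> T interior_of (T closure_of N) = {}) \<and>
          S = \<Union>\<N>)"

definition comeager :: "'b topology \<Rightarrow> 'b set \<Rightarrow> bool" where
  "comeager T S \<longleftrightarrow> S \<subseteq> topspace T \<and> meager T (topspace T - S)"

definition omega_limit :: "((int \<Rightarrow> 'a) \<Rightarrow> (int \<Rightarrow> 'a)) \<Rightarrow> (int \<Rightarrow> 'a) \<Rightarrow> (int \<Rightarrow> 'a) set" where
  "omega_limit f x = (\<Inter>N. config_topology closure_of {(f ^^ n) x | n. n \<ge> N})"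

definition attraction_domain ::
    "((int \<Rightarrow> 'a) \<Rightarrow> (int \<Rightarrow> 'a)) \<Rightarrow> (int \<Rightarrow> 'a) set \<Rightarrow> (int \<Rightarrow> 'a) set" where
  "attraction_domain f K = {x. omega_limit f x \<subseteq> K}"

definition generic_attractor ::
    "((int \<Rightarrow> 'a) \<Rightarrow> (int \<Rightarrow> 'a)) \<Rightarrow> (int \<Rightarrow> 'a) set \<Rightarrow> bool" where
  "generic_attractor f K \<longleftrightarrow>
     closedin config_topology K \<and> comeager config_topology (attraction_domain f K)"

definition generic_limit_set :: "((int \<Rightarrow> 'a) \<Rightarrow> (int \<Rightarrow> 'a)) \<Rightarrow> (int \<Rightarrow> 'a) set" where
  "generic_limit_set f = \<Inter>{K. generic_attractor f K}"

definition language :: "(int \<Rightarrow> 'a) set \<Rightarrow> 'a list set" where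
  "language X = {map x [i..i + int n - 1] | x i n. x \<in> X}"

section \<open>Recursive functions and the class \<open>\<Sigma>\<^sup>0\<^sub>1\<close>\<close>

text \<open>\<open>recursive_fun k g\<close> says that \<open>g\<close>, restricted to argument lists of length \<open>k\<close>, is a total
  recursive \<open>k\<close>-ary function: the constant zero, successor and projection functions, closed under
  composition, primitive recursion and minimisation of regular functions.  (By the Kleene normal
  form theorem, restricting minimisation to regular functions still yields all total computable
  functions.)  The values of \<open>g\<close> on lists of other lengths are irrelevant.\<close>

inductive recursive_fun :: "nat \<Rightarrow> (nat list \<Rightarrow> nat) \<Rightarrow> bool" where
  rec_zero: "recursive_fun k (\<lambda>_. 0)"
| rec_succ: "recursive_fun 1 (\<lambda>xs. Suc (xs ! 0))"
| rec_proj: "i < k \<Longrightarrow> recursive_fun k (\<lambda>xs. xs ! i)"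
| rec_comp: "recursive_fun (length hs) g \<Longrightarrow> (\<forall>h \<in> set hs. recursive_fun k h) \<Longrightarrow>
    recursive_fun k (\<lambda>xs. g (map (\<lambda>h. h xs) hs))"
| rec_prim: "recursive_fun k g \<Longrightarrow> recursive_fun (Suc (Suc k)) h \<Longrightarrow>
    recursive_fun (Suc k) (\<lambda>xs. rec_nat (g (tl xs)) (\<lambda>n v. h (n # v # tl xs)) (hd xs))"
| rec_mu: "recursive_fun (Suc k) g \<Longrightarrow> (\<forall>xs. length xs = k \<longrightarrow> (\<exists>n. g (n # xs) = 0)) \<Longrightarrow>
    recursive_fun k (\<lambda>xs. LEAST n. g (n # xs) = 0)"

definition recursive_rel :: "nat \<Rightarrow> (nat list \<Rightarrow> bool) \<Rightarrow> bool" where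
  "recursive_rel k R \<longleftrightarrow>
     (\<exists>g. recursive_fun k g \<and> (\<forall>xs. length xs = k \<longrightarrow> g xs = (if R xs then 1 else 0)))"

definition Sigma01 :: "nat set \<Rightarrow> bool" where
  "Sigma01 S \<longleftrightarrow> (\<exists>R. recursive_rel 2 R \<and> S = {n. \<exists>m. R [n, m]})"

text \<open>Words are coded by numbering the letters \<open>0, \<dots>, |A| - 1\<close> and applying the computable
  bijection \<^const>\<open>list_encode\<close>.  Any two numberings differ by a permutation of a finite set, so
  the choice does not affect the notion; we ask for the property under every numbering.\<close>

definition word_code :: "('a \<Rightarrow> nat) \<Rightarrow> 'a list \<Rightarrow> nat" where
  "word_code c w = list_encode (map c w)"

definition Sigma01_language :: "'a::finite list set \<Rightarrow> bool" where
  "Sigma01_language L \<longleftrightarrow>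
     (\<forall>c. bij_betw c (UNIV :: 'a set) {..<CARD('a)} \<longrightarrow> Sigma01 (word_code c ` L))"

end

theory Submission
  imports Defs
begin

text \<open>
  Let \<open>x\<close> be an equicontinuity point and \<open>r\<close> the radius of the local rule.  Equicontinuity turns
  some central word \<open>w\<close> of \<open>x\<close> into a blocking word: wherever \<open>w\<close> occurs in an initial
  configuration, it determines for all times a block of \<open>2 * r + 1\<close> cells, and no information can
  cross such a block.  Hence the evolution between two occurrences of \<open>w\<close> depends only on the
  initial segment from the first to the second one (\<open>blocks_isolate\<close>).

  Configurations with \<open>w\<close> far to the left and far to the right form a dense open set
  (\<open>blocks_generic\<close>).  So a word \<open>v\<close> of the generic limit set recurs in an orbit of such a
  configuration, and there the configuration may be replaced by a spatially periodic one.  The orbit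
  of the latter is eventually periodic in time, and \<open>v\<close> appears on its cycle.  Conversely, if \<open>v\<close>
  appears on the cycle of a spatially periodic configuration that contains \<open>w\<close>, then \<open>v\<close> recurs at
  the same place for a whole open set of configurations, and the Baire category theorem and
  compactness put \<open>v\<close> into the language of the generic limit set.  The topological part of both
  directions is in \<open>generic_limit_set_recurrent\<close> and \<open>generic_limit_set_meets\<close>, the resulting
  characterisation is \<open>language_generic_limit_set_iff\<close>.

  This characterisation is an existential statement about finite objects: one spatial period of the
  space-time diagram, up to the time at which a configuration showing \<open>v\<close> has returned.  Such a
  diagram can be checked locally, with bounded quantifiers only, hence by a recursive relation
  (\<open>recursive_certificate\<close>, \<open>certificate_iff\<close>).
\<close>

section \<open>The space of configurations\<close>

lemma topspace_config [simp]: "topspace config_topology = UNIV"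
  by (simp add: config_topology_def)

lemma compact_config: "compact_space (config_topology :: (int \<Rightarrow> 'a::finite) topology)"
  by (simp add: config_topology_def compact_space_product_topology compact_space_discrete_topology)

lemma Hausdorff_config: "Hausdorff_space config_topology"
  by (simp add: config_topology_def Hausdorff_space_product_topology)

lemma closedin_Compl_config: "openin config_topology U \<Longrightarrow> closedin config_topology (- U)"
  using openin_closedin_eq[of config_topology U] by (simp add: Compl_eq_Diff_UNIV)

lemma interior_of_Compl_config: "config_topology interior_of (- G) = - (config_topology closure_of G)"
  using interior_of_complement[of config_topology G] by (simp add: Compl_eq_Diff_UNIV)

lemma config_Baire:
  assumes "countable \<G>"
    and "\<And>T. T \<in> \<G> \<Longrightarrow> closedin config_topology T \<and> config_topology interior_of T = {}"
  shows "(config_topology :: (int \<Rightarrow> 'a::finite) topology) interior_of \<Union>\<G> = {}"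
proof (rule Baire_category_alt[OF _ assms])
  show "completely_metrizable_space (config_topology :: (int \<Rightarrow> 'a) topology) \<or>
     locally_compact_space (config_topology :: (int \<Rightarrow> 'a) topology) \<and>
     regular_space (config_topology :: (int \<Rightarrow> 'a) topology)"
    using compact_Hausdorff_imp_regular_space[OF compact_config Hausdorff_config]
      compact_imp_locally_compact_space[OF compact_config] by blast
qed

lemma openin_config_coordinate: "openin config_topology {y :: int \<Rightarrow> 'a. P (y i)}"
proof -
  have "continuous_map config_topology (discrete_topology UNIV) (\<lambda>y :: int \<Rightarrow> 'a. y i)"
    unfolding config_topology_def by (rule continuous_map_product_projection) simp
  from openin_continuous_map_preimage[OF this, of "Collect P"] show ?thesis by simp
qed

lemma openin_config_finite:
  assumes "finite I"
  shows "openin config_topology {y :: int \<Rightarrow> 'a. \<forall>i\<in>I. P i (y (t i))}"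
  using assms
proof (induction I)
  case (insert a I)
  have "{y :: int \<Rightarrow> 'a. \<forall>i\<in>insert a I. P i (y (t i))} = {y. P a (y (t a))} \<inter> {y. \<forall>i\<in>I. P i (y (t i))}"
    by auto
  then show ?case using insert openin_config_coordinate[of "P a" "t a"] by (simp add: openin_Int)
qed (use openin_topspace[of config_topology] in simp)

lemma closedin_config_coordinates:
  "closedin config_topology {y :: int \<Rightarrow> 'a. \<forall>i\<in>I. P i (y (t i))}"
proof -
  have "{y :: int \<Rightarrow> 'a. \<forall>i\<in>I. P i (y (t i))} = - (\<Union>i\<in>I. {y. \<not> P i (y (t i))})" by blast
  moreover have "openin config_topology (\<Union>i\<in>I. {y :: int \<Rightarrow> 'a. \<not> P i (y (t i))})"
  proof (rule openin_Union, elim imageE)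
    fix i and S :: "(int \<Rightarrow> 'a) set" assume "S = {y. \<not> P i (y (t i))}"
    then show "openin config_topology S"
      using openin_config_coordinate[of "\<lambda>c. \<not> P i c" "t i"] by simp
  qed
  ultimately show ?thesis by (simp only: closedin_Compl_config)
qed

text \<open>Basic open sets of the product topology restrict finitely many coordinates only.\<close>

lemma open_config_finite_window:
  assumes "openin config_topology W" and "y \<in> W"
  obtains B :: nat where "\<And>z :: int \<Rightarrow> 'a. (\<And>i. \<bar>i\<bar> \<le> int B \<Longrightarrow> z i = y i) \<Longrightarrow> z \<in> W"
proof -
  obtain U where U: "finite {i. U i \<noteq> (UNIV :: 'a set)}" "y \<in> Pi\<^sub>E UNIV U" "Pi\<^sub>E UNIV U \<subseteq> W"
    using assms unfolding config_topology_def openin_product_topology_alt by auto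
  obtain B where B: "\<And>i. i \<in> {i. U i \<noteq> UNIV} \<Longrightarrow> \<bar>i\<bar> \<le> B"
    using U(1) by (metis finite_imageI finite_nat_set_iff_bounded_le imageI Max_ge)
  have "z \<in> W" if "\<And>i. \<bar>i\<bar> \<le> int (nat B) \<Longrightarrow> z i = y i" for z
  proof -
    have "z i \<in> U i" for i
    proof (cases "U i = UNIV")
      case False
      then have "\<bar>i\<bar> \<le> B" using B by simp
      then have "z i = y i" by (intro that) linarith
      then show ?thesis using U(2) by (auto simp: PiE_UNIV_domain)
    qed simp
    then show ?thesis using U(3) by (auto simp: PiE_UNIV_domain)
  qed
  then show thesis by (rule that)
qed

section \<open>The generic limit set and recurrence\<close>

lemma comeager_INT_meets_open:
  fixes D :: "'i \<Rightarrow> (int \<Rightarrow> 'a::finite) set"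
  assumes "finite I" and D: "\<And>i. i \<in> I \<Longrightarrow> comeager config_topology (D i)"
    and C: "openin config_topology C" "C \<noteq> {}"
  shows "C \<inter> (\<Inter>i\<in>I. D i) \<noteq> {}"
proof
  assume empty: "C \<inter> (\<Inter>i\<in>I. D i) = {}"
  let ?P = "\<lambda>i \<N>. countable \<N> \<and> UNIV - D i = \<Union>\<N> \<and>
      (\<forall>N\<in>\<N>. config_topology interior_of (config_topology closure_of N) = {})"
  have "\<exists>\<N>. ?P i \<N>" if i: "i \<in> I" for i
  proof -
    obtain \<N> where "countable \<N>" "UNIV - D i = \<Union>\<N>"
      "\<forall>N\<in>\<N>. N \<subseteq> UNIV \<and> config_topology interior_of (config_topology closure_of N) = {}"
      using D[OF i] unfolding comeager_def meager_def topspace_config by (elim conjE exE) rule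
    then show ?thesis by (intro exI[of _ \<N>]) simp
  qed
  then have "\<forall>i\<in>I. \<exists>\<N>. ?P i \<N>" by (intro ballI)
  from bchoice[OF this] obtain \<N> where P: "\<forall>i\<in>I. ?P i (\<N> i)" by (elim exE)
  have \<N>: "countable (\<N> i)" "UNIV - D i = \<Union>(\<N> i)"
    "N \<in> \<N> i \<Longrightarrow> config_topology interior_of (config_topology closure_of N) = {}"
    if "i \<in> I" for i N
    using bspec[OF P that] by simp_all
  define \<G> where "\<G> = (\<lambda>N. config_topology closure_of N) ` (\<Union>i\<in>I. \<N> i)"
  have "config_topology interior_of \<Union>\<G> = {}"
  proof (rule config_Baire)
    show "countable \<G>" unfolding \<G>_def
      by (intro countable_image countable_UN countable_finite \<open>finite I\<close> \<N>(1))
    fix T assume "T \<in> \<G>"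
    then obtain i N where "i \<in> I" "N \<in> \<N> i" "T = config_topology closure_of N"
      unfolding \<G>_def by blast
    then show "closedin config_topology T \<and> config_topology interior_of T = {}"
      using \<N>(3) by simp
  qed
  moreover have "C \<subseteq> \<Union>\<G>"
  proof
    fix y assume "y \<in> C"
    then obtain i where "i \<in> I" "y \<notin> D i" using empty by auto
    then obtain N where "N \<in> \<N> i" "y \<in> N" using \<N>(2)[of i] by blast
    moreover have "N \<subseteq> config_topology closure_of N" by (simp add: closure_of_subset)
    ultimately show "y \<in> \<Union>\<G>" using \<open>i \<in> I\<close> unfolding \<G>_def by blast
  qed
  ultimately show False using C interior_of_maximal by blast
qed

text \<open>The closures of the tails of the orbit meet \<open>U\<close> and decrease, so compactness provides a
  common point.\<close>

lemma omega_limit_meets_closed: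
  fixes f :: "(int \<Rightarrow> 'a::finite) \<Rightarrow> (int \<Rightarrow> 'a)"
  assumes U: "closedin config_topology U" and inf: "\<exists>\<^sub>\<infinity>n. (f ^^ n) y \<in> U"
  shows "omega_limit f y \<inter> U \<noteq> {}"
proof -
  define E where "E N = config_topology closure_of {(f ^^ n) y | n. n \<ge> N} \<inter> U" for N
  have "(\<Inter>N. E N) \<noteq> {}"
  proof (rule compact_space_imp_nest[OF compact_config])
    show "closedin config_topology (E N)" for N
      unfolding E_def by (intro closedin_Int closedin_closure_of U)
    show "decseq E"
      unfolding E_def decseq_def by (intro allI impI Int_mono closure_of_mono) auto
    fix N
    obtain n where "n \<ge> N" "(f ^^ n) y \<in> U" using inf by (auto simp: INFM_nat_le)
    then have "(f ^^ n) y \<in> E N"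
      unfolding E_def using closure_of_subset[of "{(f ^^ n) y | n. n \<ge> N}" config_topology]
      by fastforce
    then show "E N \<noteq> {}" by auto
  qed
  then show ?thesis unfolding E_def omega_limit_def by blast
qed

text \<open>Finitely many generic attractors attract a common orbit that starts in \<open>C\<close>, by Baire, and
  all of them contain its limit set, which meets \<open>U\<close>.  Compactness of \<open>U\<close> passes from finite
  intersections to the intersection of all generic attractors.\<close>

lemma generic_limit_set_meets:
  fixes f :: "(int \<Rightarrow> 'a::finite) \<Rightarrow> (int \<Rightarrow> 'a)"
  assumes U: "closedin config_topology U"
    and C: "openin config_topology C" "C \<noteq> {}"
    and rec: "\<And>y. y \<in> C \<Longrightarrow> \<exists>\<^sub>\<infinity>n. (f ^^ n) y \<in> U"
  shows "U \<inter> generic_limit_set f \<noteq> {}"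
proof -
  have "U \<inter> \<Inter>\<F> \<noteq> {}" if "finite \<F>" "\<F> \<subseteq> {K. generic_attractor f K}" for \<F>
  proof -
    have "C \<inter> (\<Inter>K\<in>\<F>. attraction_domain f K) \<noteq> {}"
      by (rule comeager_INT_meets_open[OF _ _ C]) (use that in \<open>auto simp: generic_attractor_def\<close>)
    then obtain y where y: "y \<in> C" "\<And>K. K \<in> \<F> \<Longrightarrow> omega_limit f y \<subseteq> K"
      by (auto simp: attraction_domain_def)
    then show ?thesis using omega_limit_meets_closed[OF U rec[OF y(1)]] by blast
  qed
  moreover have "compactin config_topology U"
    using U compact_config closedin_compact_space by blast
  moreover have "\<forall>K\<in>{K. generic_attractor f K}. closedin config_topology K"
    by (simp add: generic_attractor_def)
  ultimately show ?thesis
    unfolding generic_limit_set_def compactin_fip by simp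
qed

text \<open>If every orbit from the dense open set \<open>G\<close> finally left \<open>U\<close>, then the complement of \<open>U\<close>
  would be a generic attractor, hence contain the generic limit set.\<close>

lemma generic_limit_set_recurrent:
  fixes f :: "(int \<Rightarrow> 'a) \<Rightarrow> (int \<Rightarrow> 'a)"
  assumes U: "openin config_topology U" and meets: "U \<inter> generic_limit_set f \<noteq> {}"
    and G: "openin config_topology G" "config_topology closure_of G = UNIV"
  shows "\<exists>y\<in>G. \<exists>\<^sub>\<infinity>n. (f ^^ n) y \<in> U"
proof (rule ccontr)
  assume not_inf: "\<not> (\<exists>y\<in>G. \<exists>\<^sub>\<infinity>n. (f ^^ n) y \<in> U)"
  have closed: "closedin config_topology (- U)" using U by (rule closedin_Compl_config)
  have "omega_limit f y \<subseteq> - U" if "y \<in> G" for y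
  proof -
    have "\<not> (\<exists>\<^sub>\<infinity>n. (f ^^ n) y \<in> U)" using not_inf that by blast
    then obtain N where "\<And>n. n \<ge> N \<Longrightarrow> (f ^^ n) y \<notin> U" unfolding INFM_nat_le by blast
    then have "{(f ^^ n) y | n. n \<ge> N} \<subseteq> - U" by blast
    then have "config_topology closure_of {(f ^^ n) y | n. n \<ge> N} \<subseteq> - U"
      by (rule closure_of_minimal[OF _ closed])
    then show ?thesis unfolding omega_limit_def by blast
  qed
  then have sub: "UNIV - attraction_domain f (- U) \<subseteq> - G" unfolding attraction_domain_def by blast
  have "closedin config_topology (- G)" using G(1) by (rule closedin_Compl_config)
  from closure_of_minimal[OF sub this]
  have "config_topology interior_of (config_topology closure_of (UNIV - attraction_domain f (- U)))
      \<subseteq> config_topology interior_of (- G)"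
    by (rule interior_of_mono)
  also have "\<dots> = {}" using G(2) by (simp add: interior_of_Compl_config)
  finally have "comeager config_topology (attraction_domain f (- U))"
    unfolding comeager_def meager_def
    by (intro conjI exI[of _ "{UNIV - attraction_domain f (- U)}"]) simp_all
  then have "generic_attractor f (- U)" using closed by (simp add: generic_attractor_def)
  then show False using meets unfolding generic_limit_set_def by blast
qed

section \<open>Words and periodic configurations\<close>

definition word_at :: "'a list \<Rightarrow> int \<Rightarrow> (int \<Rightarrow> 'a) \<Rightarrow> bool" where
  "word_at v k y \<longleftrightarrow> (\<forall>j<length v. y (k + int j) = v ! j)"

lemma word_at_iff_map: "word_at v k y \<longleftrightarrow> v = map y [k..k + int (length v) - 1]"
proof
  assume "word_at v k y"
  then show "v = map y [k..k + int (length v) - 1]"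
    by (intro nth_equalityI) (simp_all add: word_at_def)
next
  assume "v = map y [k..k + int (length v) - 1]"
  then have eq: "map y [k..k + int (length v) - 1] ! j = v ! j" for j by (rule arg_cong[OF sym])
  show "word_at v k y" unfolding word_at_def
  proof (intro allI impI)
    fix j assume "j < length v"
    then show "y (k + int j) = v ! j" using eq[of j] by simp
  qed
qed

lemma in_language_iff: "v \<in> language X \<longleftrightarrow> (\<exists>k. {y. word_at v k y} \<inter> X \<noteq> {})"
proof
  assume "v \<in> language X"
  then obtain y k n where y: "y \<in> X" "v = map y [k..k + int n - 1]" by (auto simp: language_def)
  have "length v = n" unfolding y(2) by simp
  then have "word_at v k y" unfolding word_at_iff_map by (metis y(2))
  then show "\<exists>k. {y. word_at v k y} \<inter> X \<noteq> {}" using y(1) by blast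
next
  assume "\<exists>k. {y. word_at v k y} \<inter> X \<noteq> {}"
  then obtain k y where "y \<in> X" "v = map y [k..k + int (length v) - 1]"
    by (auto simp only: word_at_iff_map Int_iff mem_Collect_eq ex_in_conv[symmetric])
  then show "v \<in> language X" unfolding language_def
    by (intro CollectI exI[of _ y] exI[of _ k] exI[of _ "length v"] conjI)
qed

lemma clopen_word_at:
  shows "openin config_topology {y. word_at v k y}" "closedin config_topology {y. word_at v k y}"
proof -
  have eq: "{y. word_at v k y} = {y. \<forall>j\<in>{..<length v}. y (k + int j) = v ! j}"
    by (simp only: word_at_def Ball_def lessThan_iff)
  show "openin config_topology {y. word_at v k y}"
    unfolding eq by (rule openin_config_finite) simp
  show "closedin config_topology {y. word_at v k y}"
    unfolding eq by (rule closedin_config_coordinates)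
qed

lemma periodic_multiple:
  assumes "\<And>i :: int. z (i + p) = z i"
  shows "z (i + q * p) = z i"
proof -
  have 1: "z (i + int n * p) = z i" for i n
    by (induction n) (auto simp: algebra_simps assms simp flip: assms[of "i + p * int _"])
  show ?thesis
    using 1[of i "nat q"] 1[of "i + q * p" "nat (- q)"] by (cases "q \<ge> 0") auto
qed

lemma periodic_mod:
  assumes "\<And>i :: int. z (i + p) = z i"
  shows "z (i mod p) = z i"
  using periodic_multiple[of z p "i mod p" "i div p", OF assms] by (simp add: mult.commute)

lemma finite_periodic:
  assumes "p > 0"
  shows "finite {z :: int \<Rightarrow> 'a::finite. \<forall>i. z (i + p) = z i}"
proof (rule finite_imageD)
  let ?res = "\<lambda>z :: int \<Rightarrow> 'a::finite. map z [0..p - 1]"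
  show "finite (?res ` {z. \<forall>i. z (i + p) = z i})"
    by (rule finite_subset[OF _ finite_lists_length_eq[of UNIV "nat p"]]) auto
  show "inj_on ?res {z. \<forall>i. z (i + p) = z i}"
  proof (intro inj_onI ext, clarify)
    fix y z :: "int \<Rightarrow> 'a::finite" and i
    assume "\<forall>i. y (i + p) = y i" "\<forall>i. z (i + p) = z i" "?res y = ?res z"
    moreover have "i mod p \<in> set [0..p - 1]" using assms by simp
    ultimately show "y i = z i" using periodic_mod[of y p i] periodic_mod[of z p i] by (metis map_eq_conv)
  qed
qed

section \<open>Blocking words\<close>

lemma config_dist_less_imp_agree:
  assumes "config_dist x y < (1/2) ^ r" "i \<in> {- int r..int r}"
  shows "x i = y i"
proof -
  let ?S = "{(1/2) ^ n | n :: nat. \<forall>i \<in> {- int n..int n}. x i = y i} :: real set"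
  have le1: "(1/2) ^ r \<le> (1 :: real)" by (simp add: power_le_one)
  then have "x 0 = y 0" using assms(1) by (auto simp: config_dist_def split: if_splits)
  then have "1 \<in> ?S" by (intro CollectI exI[of _ 0]) auto
  moreover have "Inf ?S < (1/2) ^ r" using assms(1) \<open>x 0 = y 0\<close> by (simp add: config_dist_def)
  ultimately obtain n :: nat where n: "(1/2) ^ n < ((1/2) ^ r :: real)" "\<forall>i \<in> {- int n..int n}. x i = y i"
    using cInf_lessD[of ?S] by blast
  then have "r < n" using power_strict_decreasing_iff[of "1/2 :: real" n r] by simp
  then show ?thesis using n(2) assms(2) by auto
qed

lemma agree_imp_config_dist_le:
  assumes "\<forall>i \<in> {- int m..int m}. x i = y i"
  shows "config_dist x y \<le> (1/2) ^ m"
proof -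
  have "Inf {(1/2) ^ n | n :: nat. \<forall>i \<in> {- int n..int n}. x i = y i} \<le> ((1/2) ^ m :: real)"
    by (rule cInf_lower) (use assms in \<open>auto intro!: bdd_belowI[of _ 0]\<close>)
  then show ?thesis using assms by (simp add: config_dist_def)
qed

text \<open>The word that \<open>x\<close> carries on the window of radius \<open>m\<close> is blocking: it fixes for all times
  the contents of the window of radius \<open>r\<close>.  As \<open>r\<close> is also the radius of the local rule, no
  information ever crosses this inner window.\<close>

locale blocked_automaton =
  fixes f :: "(int \<Rightarrow> 'a::finite) \<Rightarrow> (int \<Rightarrow> 'a)" and F :: "'a list \<Rightarrow> 'a" and r :: nat
    and x :: "int \<Rightarrow> 'a" and m :: nat
  assumes local_rule: "f y i = F (map y [i - int r..i + int r])"
    and blocking: "\<forall>i\<in>{- int m..int m}. y i = x i \<Longrightarrow> i \<in> {- int r..int r} \<Longrightarrow>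
      (f ^^ n) y i = (f ^^ n) x i"

lemma equicontinuity_point_imp_blocked_automaton:
  assumes "cellular_automaton f" "equicontinuity_point f x"
  obtains F r m where "blocked_automaton f F r x m"
proof -
  obtain r F where rule: "\<And>y i. f y i = F (map y [i - int r..i + int r])"
    using assms(1) by (auto simp: cellular_automaton_def)
  \<comment> \<open>Distances below \<open>(1/2) ^ r\<close> force agreement on the window of radius \<open>r\<close>.\<close>
  have "(1/2) ^ r > (0 :: real)" by simp
  then obtain \<delta> where \<delta>: "\<delta> > 0"
    "\<And>y n. config_dist x y < \<delta> \<Longrightarrow> config_dist ((f ^^ n) x) ((f ^^ n) y) < (1/2) ^ r"
    using assms(2) unfolding equicontinuity_point_def by meson
  obtain m where m: "(1/2) ^ m < \<delta>" using real_arch_pow_inv[OF \<delta>(1), of "1/2"] by auto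
  have "blocked_automaton f F r x m"
  proof (unfold_locales, rule rule)
    fix y i n assume y: "\<forall>i\<in>{- int m..int m}. y i = x i" and i: "i \<in> {- int r..int r}"
    have "config_dist x y < \<delta>" using agree_imp_config_dist_le[of m x y] y m by force
    from config_dist_less_imp_agree[OF \<delta>(2)[OF this] i] show "(f ^^ n) y i = (f ^^ n) x i" by simp
  qed
  then show thesis by (rule that)
qed

context blocked_automaton
begin

lemma iterate_translate: "(f ^^ n) (\<lambda>j. y (j + a)) = (\<lambda>j. (f ^^ n) y (j + a))"
proof (induction n)
  case (Suc n)
  have "map (\<lambda>j. z (j + a)) [i - int r..i + int r] = map z [i + a - int r..i + a + int r]" for z :: "int \<Rightarrow> 'a" and i
    by (rule nth_equalityI) (auto simp: algebra_simps)
  then show ?case using Suc by (simp add: local_rule)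
qed simp

lemma rule_cong: "(\<And>j. j \<in> {i - int r..i + int r} \<Longrightarrow> y j = z j) \<Longrightarrow> f y i = f z i"
  unfolding local_rule by (intro arg_cong[where f = F] map_cong) auto

definition block_at :: "(int \<Rightarrow> 'a) \<Rightarrow> int \<Rightarrow> bool" where
  "block_at y a \<longleftrightarrow> (\<forall>i\<in>{- int m..int m}. y (a + i) = x i)"

lemma block_at_iterate:
  assumes "block_at y a" "i \<in> {a - int r..a + int r}"
  shows "(f ^^ n) y i = (f ^^ n) x (i - a)"
proof -
  have "(f ^^ n) (\<lambda>j. y (j + a)) (i - a) = (f ^^ n) x (i - a)"
    by (rule blocking) (use assms in \<open>auto simp: block_at_def add.commute\<close>)
  then show ?thesis by (simp add: iterate_translate)
qed

text \<open>Induction on time: a cell between the two centres reads only cells on which both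
  configurations agreed one step earlier, and the flanks outside the centres are dictated by the
  blocking words, so that nothing from beyond the two blocks gets in.\<close>

lemma blocks_isolate:
  assumes y: "block_at y a" "block_at y b" and ab: "a \<le> b"
    and agree: "\<forall>i\<in>{a - int m..b + int m}. z i = y i"
    and i: "i \<in> {a - int r..b + int r}"
  shows "(f ^^ n) z i = (f ^^ n) y i"
proof -
  have z: "block_at z a" "block_at z b" using y agree ab by (auto simp: block_at_def)
  have near: "(f ^^ n) z i = (f ^^ n) y i"
    if "i \<in> {a - int r..a + int r} \<union> {b - int r..b + int r}" for n i
    using that block_at_iterate[OF y(1), of i n] block_at_iterate[OF y(2), of i n]
      block_at_iterate[OF z(1), of i n] block_at_iterate[OF z(2), of i n] by auto
  show ?thesis using i
  proof (induction n arbitrary: i)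
    case 0
    show ?case
    proof (cases "i \<in> {a..b}")
      case True
      then show ?thesis using agree by simp
    qed (use near[of i 0] 0 in auto)
  next
    case (Suc n)
    show ?case
    proof (cases "i \<in> {a..b}")
      case True
      then have "f ((f ^^ n) z) i = f ((f ^^ n) y) i" by (intro rule_cong Suc.IH) auto
      then show ?thesis by simp
    qed (use near[of i "Suc n"] Suc in auto)
  qed
qed

lemma open_block_at: "openin config_topology {y. block_at y a}"
  unfolding block_at_def by (rule openin_config_finite) simp

lemma blocks_generic:
  defines "G \<equiv> \<lambda>lo hi. {y. (\<exists>a\<le>lo. block_at y a) \<and> (\<exists>b\<ge>hi. block_at y b)}"
  shows "openin config_topology (G lo hi)" "config_topology closure_of (G lo hi) = UNIV"
proof -
  have "G lo hi = (\<Union>a\<in>{..lo}. {y. block_at y a}) \<inter> (\<Union>b\<in>{hi..}. {y. block_at y b})"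
    by (auto simp: G_def)
  then show "openin config_topology (G lo hi)"
    by (auto intro!: openin_Int openin_Union open_block_at)
  have "\<exists>z\<in>G lo hi. z \<in> W" if W: "y \<in> W \<and> openin config_topology W" for y W
  proof -
    obtain B where B: "\<And>z. (\<And>i. \<bar>i\<bar> \<le> int B \<Longrightarrow> z i = y i) \<Longrightarrow> z \<in> W"
      using open_config_finite_window W by blast
    \<comment> \<open>Plant a copy of the blocking word on either side, far beyond the window that decides \<open>W\<close>.\<close>
    define c where "c = \<bar>lo\<bar> + \<bar>hi\<bar> + int B + int m + 1"
    define z where "z i = (if i < - int B then x (i + c) else if i > int B then x (i - c) else y i)" for i
    have "block_at z (- c)" "block_at z c" by (auto simp: block_at_def z_def c_def)
    moreover have "- c \<le> lo" "c \<ge> hi" by (auto simp: c_def)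
    moreover have "z \<in> W" by (rule B) (auto simp: z_def)
    ultimately show ?thesis by (auto simp: G_def)
  qed
  then have "y \<in> config_topology closure_of (G lo hi)" for y by (simp add: in_closure_of) blast
  then show "config_topology closure_of (G lo hi) = UNIV" by blast
qed

lemma iterate_periodic:
  assumes "\<And>i. z (i + p) = z i"
  shows "(f ^^ n) z (i + p) = (f ^^ n) z i"
  using iterate_translate[of n z p] assms by (simp add: fun_eq_iff)

text \<open>The heart of the proof: membership is witnessed by finite data.  A generic orbit along which
  \<open>v\<close> recurs starts with a blocking word on either side of the place of \<open>v\<close>; repeating the segment
  between them periodically does not change what happens there, and the orbit of a spatially
  periodic configuration lives in a finite set, so that some configuration showing \<open>v\<close> returns.
  Conversely, on a cycle \<open>v\<close> recurs forever, and it does so for all configurations that agree with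
  \<open>z\<close> on a large window; these form a nonempty open set.\<close>

lemma language_generic_limit_set_iff:
  "v \<in> language (generic_limit_set f) \<longleftrightarrow>
    (\<exists>z p k s t. 0 < p \<and> (\<forall>i. z (i + int p) = z i) \<and> block_at z (int m) \<and>
      s < t \<and> (f ^^ s) z = (f ^^ t) z \<and> word_at v (int k) ((f ^^ s) z))"
    (is "_ \<longleftrightarrow> (\<exists>z p k s t. ?cert z p k s t)")
proof
  assume "v \<in> language (generic_limit_set f)"
  then obtain k where "{y. word_at v k y} \<inter> generic_limit_set f \<noteq> {}" by (auto simp: in_language_iff)
  from generic_limit_set_recurrent[OF clopen_word_at(1) this
      blocks_generic(1)[of k "k + int (length v)"] blocks_generic(2)[of k "k + int (length v)"]]
  obtain y a b where a: "a \<le> k" "block_at y a" and b: "k + int (length v) \<le> b" "block_at y b"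
    and inf: "\<exists>\<^sub>\<infinity>n. word_at v k ((f ^^ n) y)" by auto
  \<comment> \<open>One period is the segment from the left end of the first block to the right end of the
    second, moved so that it starts at coordinate 0.\<close>
  define p where "p = nat (b - a + 2 * int m + 1)"
  define z where "z i = y (i mod int p + (a - int m))" for i
  have p: "int p = b - a + 2 * int m + 1" "p > 0" using a b by (auto simp: p_def)
  have per: "\<forall>i. z (i + int p) = z i" by (simp add: z_def)
  have z: "z i = y (i + (a - int m))" if "0 \<le> i" "i < int p" for i using that by (simp add: z_def)
  have block: "block_at z (int m)" using a b by (auto simp: block_at_def z p add.commute)
  define k' where "k' = nat (k - a + int m)"
  have k': "int k' = k - a + int m" using a by (simp add: k'_def)
  have "word_at v (int k') ((f ^^ n) z)" if "word_at v k ((f ^^ n) y)" for n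
    unfolding word_at_def
  proof (intro allI impI)
    fix j assume j: "j < length v"
    have "(f ^^ n) (\<lambda>i. z (i + (int m - a))) (k + int j) = (f ^^ n) y (k + int j)"
      by (rule blocks_isolate[OF a(2) b(2)]) (use a b j in \<open>auto simp: z p\<close>)
    then show "(f ^^ n) z (int k' + int j) = v ! j"
      using that j unfolding iterate_translate by (simp add: word_at_def k' algebra_simps)
  qed
  with inf have "infinite {n. word_at v (int k') ((f ^^ n) z)}" (is "infinite ?T")
    by (simp add: INFM_iff_infinite) (metis (mono_tags, lifting) Collect_mono rev_finite_subset)
  moreover have "(\<lambda>n. (f ^^ n) z) ` ?T \<subseteq> {z. \<forall>i. z (i + int p) = z i}"
    using iterate_periodic[of z "int p"] per by auto
  then have "finite ((\<lambda>n. (f ^^ n) z) ` ?T)"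
    by (rule finite_subset[OF _ finite_periodic]) (use p(2) in simp)
  ultimately have "\<not> inj_on (\<lambda>n. (f ^^ n) z) ?T" using finite_imageD by blast
  then obtain s t where "s \<in> ?T" "s < t" "(f ^^ s) z = (f ^^ t) z"
    unfolding inj_on_def by (metis linorder_neqE_nat)
  then show "\<exists>z p k s t. ?cert z p k s t" using p(2) per block by blast
next
  assume "\<exists>z p k s t. ?cert z p k s t"
  then obtain z p k s t where p: "0 < p" and per: "\<And>i. z (i + int p) = z i" and block: "block_at z (int m)"
    and st: "s < t" "(f ^^ s) z = (f ^^ t) z" and v: "word_at v (int k) ((f ^^ s) z)" by blast
  have block': "block_at z (int m + q * int p)" for q
  proof -
    have "z (int m + q * int p + i) = z (int m + i)" for i
      using periodic_multiple[of z "int p" "int m + i" q, OF per] by (simp add: algebra_simps)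
    then show ?thesis using block by (simp add: block_at_def)
  qed
  \<comment> \<open>Copies of the block of \<open>z\<close> to the left and to the right of the occurrence of \<open>v\<close>.
    Since periods have length at least 1, so many of them lead far enough.\<close>
  define a where "a = int m + (- int m) * int p"
  define b where "b = int m + int (k + length v) * int p"
  have "int m * 1 \<le> int m * int p" "int (k + length v) * 1 \<le> int (k + length v) * int p"
    using p by (intro mult_left_mono; simp)+
  then have ab: "a \<le> 0" "int (k + length v) \<le> b" by (auto simp: a_def b_def)
  have repeat: "(f ^^ (s + i * (t - s))) z = (f ^^ s) z" for i
  proof (induction i)
    case (Suc i)
    have "s + Suc i * (t - s) = (t - s) + (s + i * (t - s))" by simp
    then have "(f ^^ (s + Suc i * (t - s))) z = (f ^^ (t - s)) ((f ^^ (s + i * (t - s))) z)"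
      by (simp only: funpow_add[of "t - s"] o_apply)
    also have "\<dots> = (f ^^ (t - s)) ((f ^^ s) z)" by (simp only: Suc)
    also have "\<dots> = (f ^^ (t - s + s)) z" by (simp only: funpow_add o_apply)
    also have "\<dots> = (f ^^ s) z" using st by simp
    finally show ?case .
  qed simp
  let ?C = "{y. \<forall>i\<in>{a - int m..b + int m}. y i = z i}"
  have "{y. word_at v (int k) y} \<inter> generic_limit_set f \<noteq> {}"
  proof (rule generic_limit_set_meets[OF clopen_word_at(2)])
    show "openin config_topology ?C"
      by (rule openin_config_finite) simp
    fix y assume y: "y \<in> ?C"
    show "\<exists>\<^sub>\<infinity>n. (f ^^ n) y \<in> {y. word_at v (int k) y}" unfolding INFM_nat_le
    proof
      fix N
      let ?n = "s + N * (t - s)"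
      have "(f ^^ ?n) y (int k + int j) = (f ^^ s) z (int k + int j)" if "j < length v" for j
        unfolding repeat[of N, symmetric]
        by (rule blocks_isolate[of z a b])
          (use that ab y in \<open>auto simp: block' a_def[symmetric] b_def[symmetric]
            intro: block'[of "- int m", folded a_def] block'[of "int (k + length v)", folded b_def]\<close>)
      then have "word_at v (int k) ((f ^^ ?n) y)" using v by (simp add: word_at_def)
      moreover have "N \<le> ?n" using st(1) by (cases "t - s") auto
      ultimately show "\<exists>n\<ge>N. (f ^^ n) y \<in> {y. word_at v (int k) y}"
        by blast
    qed
  qed auto
  then show "v \<in> language (generic_limit_set f)" by (auto simp: in_language_iff)
qed

end

section \<open>Recursive functions\<close>

text \<open>Agreement is required on lists of length \<open>k\<close> only, so that functions can be rewritten using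
  the length of their argument list; \<^const>\<open>recursive_fun\<close> itself does not allow this.\<close>

definition computable :: "nat \<Rightarrow> (nat list \<Rightarrow> nat) \<Rightarrow> bool" where
  "computable k g \<longleftrightarrow> (\<exists>g'. recursive_fun k g' \<and> (\<forall>xs. length xs = k \<longrightarrow> g' xs = g xs))"

lemma recursive_rel_iff_computable: "recursive_rel k R \<longleftrightarrow> computable k (\<lambda>xs. if R xs then 1 else 0)"
  by (simp add: recursive_rel_def computable_def)

lemma computable_cong: "(\<And>xs. length xs = k \<Longrightarrow> g xs = h xs) \<Longrightarrow> computable k g \<Longrightarrow> computable k h"
  unfolding computable_def by metis

lemma recursive_rel_cong:
  "(\<And>xs. length xs = k \<Longrightarrow> R xs \<longleftrightarrow> S xs) \<Longrightarrow> recursive_rel k R \<Longrightarrow> recursive_rel k S"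
  unfolding recursive_rel_iff_computable by (erule computable_cong[rotated]) simp

lemma computable_proj: "i < k \<Longrightarrow> computable k (\<lambda>xs. xs ! i)"
  unfolding computable_def using rec_proj by blast

lemma computable_comp:
  assumes "computable (length hs) g" "\<And>h. h \<in> set hs \<Longrightarrow> computable k h"
  shows "computable k (\<lambda>xs. g (map (\<lambda>h. h xs) hs))"
proof -
  obtain g' where g': "recursive_fun (length hs) g'" "\<And>xs. length xs = length hs \<Longrightarrow> g' xs = g xs"
    using assms(1) by (auto simp: computable_def)
  have "\<exists>F. \<forall>h\<in>set hs. recursive_fun k (F h) \<and> (\<forall>xs. length xs = k \<longrightarrow> F h xs = h xs)"
    using assms(2) unfolding computable_def by (intro bchoice) blast
  then obtain F where F: "\<And>h. h \<in> set hs \<Longrightarrow> recursive_fun k (F h)"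
    "\<And>h xs. h \<in> set hs \<Longrightarrow> length xs = k \<Longrightarrow> F h xs = h xs" by blast
  have "recursive_fun k (\<lambda>xs. g' (map (\<lambda>h. h xs) (map F hs)))"
    by (rule rec_comp) (use g' F in auto)
  moreover have "g' (map (\<lambda>h. h xs) (map F hs)) = g (map (\<lambda>h. h xs) hs)" if "length xs = k" for xs
  proof -
    have "map (\<lambda>h. h xs) (map F hs) = map (\<lambda>h. h xs) hs" using F(2) that by simp
    then show ?thesis using g'(2)[of "map (\<lambda>h. h xs) hs"] by (simp only: length_map)
  qed
  ultimately show ?thesis unfolding computable_def by blast
qed

lemma recursive_rel_comp:
  assumes "recursive_rel (length hs) R" "\<And>h. h \<in> set hs \<Longrightarrow> computable k h"
  shows "recursive_rel k (\<lambda>xs. R (map (\<lambda>h. h xs) hs))"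
  using assms computable_comp[of hs "\<lambda>xs. if R xs then 1 else 0" k] by (simp add: recursive_rel_iff_computable)

lemma computable_comp1: "computable 1 (\<lambda>xs. F (xs ! 0)) \<Longrightarrow> computable k a \<Longrightarrow> computable k (\<lambda>xs. F (a xs))"
  using computable_comp[of "[a]" "\<lambda>xs. F (xs ! 0)" k] by simp

lemma computable_comp2:
  "computable 2 (\<lambda>xs. F (xs ! 0) (xs ! 1)) \<Longrightarrow> computable k a \<Longrightarrow> computable k b \<Longrightarrow>
    computable k (\<lambda>xs. F (a xs) (b xs))"
  using computable_comp[of "[a, b]" "\<lambda>xs. F (xs ! 0) (xs ! 1)" k] by (auto simp: numeral_2_eq_2)

lemma map_nth_upt_drop: "length xs = k + n \<Longrightarrow> map (\<lambda>i. xs ! (i + n)) [0..<k] = drop n xs"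
  by (rule nth_equalityI) (auto simp: add.commute)

lemma computable_drop:
  assumes "computable k g"
  shows "computable (k + n) (\<lambda>xs. g (drop n xs))"
proof (rule computable_cong)
  show "computable (k + n) (\<lambda>xs. g (map (\<lambda>h. h xs) (map (\<lambda>i xs. xs ! (i + n)) [0..<k])))"
    by (rule computable_comp) (use assms in \<open>auto intro: computable_proj\<close>)
qed (simp add: o_def map_nth_upt_drop)

lemma computable_Suc: "computable k a \<Longrightarrow> computable k (\<lambda>xs. Suc (a xs))"
  by (rule computable_comp1[of Suc]) (use rec_succ in \<open>auto simp: computable_def\<close>)

lemma computable_const: "computable k (\<lambda>_. n)"
proof (induction n)
  case 0
  then show ?case using rec_zero by (auto simp: computable_def)
qed (rule computable_Suc)

text \<open>Primitive recursion where the number of steps may be any recursive function of the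
  parameters.\<close>

lemma computable_rec_nat:
  assumes g: "computable k g" and h: "computable (Suc (Suc k)) h" and a: "computable k a"
    and H: "\<And>n v xs. length xs = k \<Longrightarrow> h (n # v # xs) = H n v xs"
  shows "computable k (\<lambda>xs. rec_nat (g xs) (\<lambda>n v. H n v xs) (a xs))"
proof -
  obtain g' where g': "recursive_fun k g'" "\<And>xs. length xs = k \<Longrightarrow> g' xs = g xs"
    using g by (auto simp: computable_def)
  obtain h' where h': "recursive_fun (Suc (Suc k)) h'" "\<And>xs. length xs = Suc (Suc k) \<Longrightarrow> h' xs = h xs"
    using h by (auto simp: computable_def)
  have step: "computable (Suc k) (\<lambda>xs. rec_nat (g' (tl xs)) (\<lambda>n v. h' (n # v # tl xs)) (hd xs))"
    using rec_prim[OF g'(1) h'(1)] by (auto simp: computable_def)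
  have "computable k (\<lambda>xs. (\<lambda>xs. rec_nat (g' (tl xs)) (\<lambda>n v. h' (n # v # tl xs)) (hd xs))
      (map (\<lambda>h. h xs) (a # map (\<lambda>i xs. xs ! i) [0..<k])))" (is "computable k ?F")
    by (rule computable_comp) (use step a in \<open>auto intro: computable_proj\<close>)
  then show ?thesis
  proof (rule computable_cong[rotated])
    fix xs :: "nat list" assume len: "length xs = k"
    then have "map (\<lambda>i. xs ! i) [0..<k] = xs" by (metis map_nth)
    then show "?F xs = rec_nat (g xs) (\<lambda>n v. H n v xs) (a xs)"
      using len by (simp add: o_def g'(2) h'(2) H)
  qed
qed

lemma computable_Least:
  assumes R: "recursive_rel (Suc k) R" and ex: "\<And>xs. length xs = k \<Longrightarrow> \<exists>n. R (n # xs)"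
  shows "computable k (\<lambda>xs. LEAST n. R (n # xs))"
proof -
  have "computable (Suc k) (\<lambda>xs. if R xs then 0 else 1)"
  proof (rule computable_cong)
    show "computable (Suc k) (\<lambda>xs. rec_nat 1 (\<lambda>_ _. 0) (if R xs then 1 else 0))"
      by (rule computable_rec_nat[of _ _ "\<lambda>_. 0"]) (use R in \<open>auto simp: recursive_rel_iff_computable intro: computable_const\<close>)
  qed simp
  then obtain g where g: "recursive_fun (Suc k) g"
    "\<And>xs. length xs = Suc k \<Longrightarrow> g xs = (if R xs then 0 else 1)"
    by (auto simp: computable_def)
  have "recursive_fun k (\<lambda>xs. LEAST n. g (n # xs) = 0)"
    by (rule rec_mu[OF g(1)]) (use ex g(2) in auto)
  moreover have "(LEAST n. g (n # xs) = 0) = (LEAST n. R (n # xs))" if "length xs = k" for xs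
    using that by (simp add: g(2))
  ultimately show ?thesis unfolding computable_def by blast
qed

lemma computable_if:
  assumes "recursive_rel k P" "computable k a" "computable k b"
  shows "computable k (\<lambda>xs. if P xs then a xs else b xs)"
proof (rule computable_cong)
  show "computable k (\<lambda>xs. rec_nat (b xs) (\<lambda>_ _. a xs) (if P xs then 1 else 0))"
    by (rule computable_rec_nat[of _ _ "\<lambda>xs. a (drop 2 xs)"])
      (use assms computable_drop[of k a 2] in \<open>auto simp: recursive_rel_iff_computable\<close>)
qed simp

lemma recursive_rel_const: "recursive_rel k (\<lambda>_. b)"
  using computable_const by (simp add: recursive_rel_iff_computable)

lemma recursive_rel_not: "recursive_rel k P \<Longrightarrow> recursive_rel k (\<lambda>xs. \<not> P xs)"
  using computable_if[OF _ computable_const[of k 0] computable_const[of k 1], of P]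
  by (auto simp: recursive_rel_iff_computable intro: computable_cong[rotated])

lemma recursive_rel_conj:
  assumes "recursive_rel k P" "recursive_rel k Q"
  shows "recursive_rel k (\<lambda>xs. P xs \<and> Q xs)"
  unfolding recursive_rel_iff_computable
  by (rule computable_cong[OF _ computable_if[OF assms(1) assms(2)[unfolded recursive_rel_iff_computable] computable_const[of k 0]]]) simp

lemma recursive_rel_disj:
  assumes "recursive_rel k P" "recursive_rel k Q"
  shows "recursive_rel k (\<lambda>xs. P xs \<or> Q xs)"
  using recursive_rel_not[OF recursive_rel_conj[OF assms[THEN recursive_rel_not]]] by simp

lemma recursive_rel_finite_ball:
  "finite I \<Longrightarrow> (\<And>i. i \<in> I \<Longrightarrow> recursive_rel k (P i)) \<Longrightarrow> recursive_rel k (\<lambda>xs. \<forall>i\<in>I. P i xs)"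
  by (induction I rule: finite_induct) (auto intro: recursive_rel_const recursive_rel_conj)

lemma recursive_rel_finite_bex:
  "finite I \<Longrightarrow> (\<And>i. i \<in> I \<Longrightarrow> recursive_rel k (P i)) \<Longrightarrow> recursive_rel k (\<lambda>xs. \<exists>i\<in>I. P i xs)"
  by (induction I rule: finite_induct) (auto intro: recursive_rel_const recursive_rel_disj)

text \<open>In the relation \<open>R\<close> the quantified number is the first entry and shifts the other
  ones; \<open>Q\<close> is the same condition in terms of the unshifted list.\<close>

lemma recursive_rel_all_less:
  assumes R: "recursive_rel (Suc k) R" and a: "computable k a"
    and Q: "\<And>n xs. length xs = k \<Longrightarrow> R (n # xs) = Q n xs"
  shows "recursive_rel k (\<lambda>xs. \<forall>n<a xs. Q n xs)"
  unfolding recursive_rel_iff_computable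
proof (rule computable_cong)
  let ?h = "\<lambda>xs. if R (xs ! 0 # drop 2 xs) then xs ! 1 else 0"
  have "recursive_rel (Suc (Suc k)) (\<lambda>xs. R (map (\<lambda>h. h xs) ((\<lambda>xs. xs ! 0) # map (\<lambda>i xs. xs ! (i + 2)) [0..<k])))"
    by (rule recursive_rel_comp) (use R in \<open>auto intro: computable_proj\<close>)
  then have "recursive_rel (Suc (Suc k)) (\<lambda>xs. R (xs ! 0 # drop 2 xs))"
    by (rule recursive_rel_cong[rotated]) (simp add: o_def map_nth_upt_drop[of _ k 2, simplified])
  then have "computable (Suc (Suc k)) ?h" by (intro computable_if computable_proj computable_const) auto
  from computable_rec_nat[OF computable_const[of k 1] this a, of "\<lambda>n v xs. if Q n xs then v else 0"]
  show "computable k (\<lambda>xs. rec_nat 1 (\<lambda>n v. if Q n xs then v else 0) (a xs))" by (simp add: Q)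
  have "rec_nat 1 (\<lambda>n v. if Q n xs then v else 0) b = (if \<forall>n<b. Q n xs then 1 else 0)" for xs b
    by (induction b) (auto simp: less_Suc_eq)
  then show "rec_nat 1 (\<lambda>n v. if Q n xs then v else 0) (a xs) = (if \<forall>n<a xs. Q n xs then 1 else 0)" for xs .
qed

lemma recursive_rel_ex_less:
  assumes R: "recursive_rel (Suc k) R" and a: "computable k a"
    and Q: "\<And>n xs. length xs = k \<Longrightarrow> R (n # xs) = Q n xs"
  shows "recursive_rel k (\<lambda>xs. \<exists>n<a xs. Q n xs)"
  using recursive_rel_not[OF recursive_rel_all_less[OF recursive_rel_not[OF R] a, of "\<lambda>n xs. \<not> Q n xs"]]
  by (simp add: Q)

subsection \<open>Arithmetic\<close>

lemma computable_add:
  assumes "computable k a" "computable k b" shows "computable k (\<lambda>xs. a xs + b xs)"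
proof -
  have "rec_nat m (\<lambda>_ v. Suc v) n = m + n" for m n by (induction n) auto
  then show ?thesis
    using computable_rec_nat[OF assms(1) computable_Suc[OF computable_proj[of 1]] assms(2), of "\<lambda>_ v _. Suc v"] by simp
qed

lemma computable_pred:
  assumes "computable k a" shows "computable k (\<lambda>xs. a xs - 1)"
proof -
  have "rec_nat 0 (\<lambda>n _. n) n = n - 1" for n by (induction n) auto
  then show ?thesis
    using computable_rec_nat[OF computable_const[of _ 0] computable_proj[of 0] assms, of "\<lambda>n _ _. n"] by simp
qed

lemma computable_diff:
  assumes "computable k a" "computable k b" shows "computable k (\<lambda>xs. a xs - b xs)"
proof -
  have "rec_nat m (\<lambda>_ v. v - 1) n = m - n" for m n by (induction n) auto
  then show ?thesis
    using computable_rec_nat[OF assms(1) computable_pred[OF computable_proj[of 1]] assms(2), of "\<lambda>_ v _. v - 1"] by simp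
qed

lemma recursive_rel_eq_0:
  assumes "computable k a" shows "recursive_rel k (\<lambda>xs. a xs = 0)"
proof -
  have "rec_nat 1 (\<lambda>_ _. 0) n = (if n = 0 then 1 else 0 :: nat)" for n by (cases n) auto
  then show ?thesis unfolding recursive_rel_iff_computable
    using computable_rec_nat[OF computable_const[of _ 1] computable_const[of _ 0] assms, of "\<lambda>_ _ _. 0"] by simp
qed

lemma recursive_rel_less:
  assumes "computable k a" "computable k b" shows "recursive_rel k (\<lambda>xs. a xs < b xs)"
  using recursive_rel_not[OF recursive_rel_eq_0[OF computable_diff[OF assms(2,1)]]] by (simp add: not_le)

lemma recursive_rel_eq:
  assumes "computable k a" "computable k b" shows "recursive_rel k (\<lambda>xs. a xs = b xs)"
  using recursive_rel_conj[OF recursive_rel_not[OF recursive_rel_less[OF assms]]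
      recursive_rel_not[OF recursive_rel_less[OF assms(2,1)]]]
  by (rule recursive_rel_cong[rotated]) auto

lemma computable_mod:
  assumes "computable k a" "computable k b" shows "computable k (\<lambda>xs. a xs mod b xs)"
proof -
  have eq: "rec_nat 0 (\<lambda>_ v. if Suc v = b then 0 else Suc v) n = n mod b" for n b :: nat
    by (induction n) (auto simp: mod_Suc)
  have "computable 2 (\<lambda>xs. rec_nat 0 (\<lambda>_ v. if Suc v = xs ! 1 then 0 else Suc v) (xs ! 0))"
    by (rule computable_rec_nat[of _ _ "\<lambda>xs. if Suc (xs ! 1) = xs ! 3 then 0 else Suc (xs ! 1)"])
      (auto intro!: computable_if recursive_rel_eq computable_Suc computable_proj computable_const simp: numeral_3_eq_3)
  from computable_comp2[OF this[unfolded eq] assms] show ?thesis .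
qed

text \<open>Membership in a finite set of lists is a finite disjunction of conjunctions of equations;
  this is all that is needed to express the local rule.\<close>

lemma recursive_rel_list_mem:
  assumes "finite A" "\<And>h. h \<in> set hs \<Longrightarrow> computable k h"
  shows "recursive_rel k (\<lambda>xs. map (\<lambda>h. h xs) hs \<in> A)"
proof -
  have "recursive_rel k (\<lambda>xs. \<exists>ys\<in>A. length ys = length hs \<and> (\<forall>i\<in>{..<length hs}. (hs ! i) xs = ys ! i))"
    by (intro recursive_rel_finite_bex recursive_rel_conj recursive_rel_const
        recursive_rel_finite_ball recursive_rel_eq computable_const) (use assms in auto)
  then show ?thesis
  proof (rule recursive_rel_cong[rotated])
    fix xs
    have "(length ys = length hs \<and> (\<forall>i\<in>{..<length hs}. (hs ! i) xs = ys ! i)) \<longleftrightarrow> ys = map (\<lambda>h. h xs) hs" for ys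
      by (auto simp: list_eq_iff_nth_eq)
    then show "(\<exists>ys\<in>A. length ys = length hs \<and> (\<forall>i\<in>{..<length hs}. (hs ! i) xs = ys ! i)) \<longleftrightarrow>
        map (\<lambda>h. h xs) hs \<in> A" by auto
  qed
qed

subsection \<open>Codes of pairs and lists\<close>

lemma computable_prod_encode:
  assumes "computable k a" "computable k b" shows "computable k (\<lambda>xs. prod_encode (a xs, b xs))"
proof -
  have "rec_nat 0 (\<lambda>n v. v + Suc n) n = triangle n" for n by (induction n) auto
  then have "computable 1 (\<lambda>xs. triangle (xs ! 0))"
    using computable_rec_nat[OF computable_const[of 1 0] computable_add[OF computable_proj[of 1] computable_Suc[OF computable_proj[of 0]]] computable_proj[of 0],
      of "\<lambda>n v _. v + Suc n"] by simp
  from computable_add[OF computable_comp1[OF this computable_add[OF assms]] assms(1)] show ?thesis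
    by (simp add: prod_encode_def)
qed

text \<open>Both components are found by minimisation; they are bounded by the code of the pair, so the
  inner quantifier may be bounded.\<close>

lemma computable_fst_prod_decode:
  assumes "computable k a" shows "computable k (\<lambda>xs. fst (prod_decode (a xs)))"
proof -
  have *: "(\<exists>y<Suc n. prod_encode (x, y) = n) \<longleftrightarrow> x = fst (prod_decode n)" for x n
  proof
    assume "x = fst (prod_decode n)"
    moreover have "snd (prod_decode n) < Suc n"
      using le_prod_encode_2[of "snd (prod_decode n)" "fst (prod_decode n)"] by simp
    ultimately show "\<exists>y<Suc n. prod_encode (x, y) = n" by (intro exI[of _ "snd (prod_decode n)"]) simp
  qed auto
  have "recursive_rel 2 (\<lambda>xs. \<exists>y<Suc (xs ! 1). prod_encode (xs ! 0, y) = xs ! 1)"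
    by (rule recursive_rel_ex_less[of _ "\<lambda>xs. prod_encode (xs ! 1, xs ! 0) = xs ! 2"])
      (auto intro!: recursive_rel_eq computable_prod_encode computable_proj computable_Suc)
  then have "computable 1 (\<lambda>xs. fst (prod_decode (xs ! 0)))"
    using computable_Least[of 1 "\<lambda>xs. \<exists>y<Suc (xs ! 1). prod_encode (xs ! 0, y) = xs ! 1"]
    by (simp add: * numeral_2_eq_2 Least_equality)
  from computable_comp1[OF this assms] show ?thesis .
qed

lemma computable_snd_prod_decode:
  assumes "computable k a" shows "computable k (\<lambda>xs. snd (prod_decode (a xs)))"
proof -
  have *: "prod_encode (fst (prod_decode n), y) = n \<longleftrightarrow> y = snd (prod_decode n)" for y n
    by (metis fst_conv prod.collapse prod_decode_inverse prod_encode_inverse snd_conv)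
  have "recursive_rel 2 (\<lambda>xs. prod_encode (fst (prod_decode (xs ! 1)), xs ! 0) = xs ! 1)"
    by (auto intro!: recursive_rel_eq computable_prod_encode computable_proj computable_fst_prod_decode)
  then have "computable 1 (\<lambda>xs. snd (prod_decode (xs ! 0)))"
    using computable_Least[of 1 "\<lambda>xs. prod_encode (fst (prod_decode (xs ! 1)), xs ! 0) = xs ! 1"]
    by (simp add: * numeral_2_eq_2 Least_equality)
  from computable_comp1[OF this assms] show ?thesis .
qed

text \<open>Dropping continues harmlessly beyond the end of the list: the code \<open>0\<close> of the empty list is
  its own tail, because \<open>prod_decode 0 = (0, 0)\<close>.\<close>

definition code_drop :: "nat \<Rightarrow> nat \<Rightarrow> nat" where
  "code_drop n i = rec_nat n (\<lambda>_ v. snd (prod_decode (v - 1))) i"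

definition code_nth :: "nat \<Rightarrow> nat \<Rightarrow> nat" where
  "code_nth n i = fst (prod_decode (code_drop n i - 1))"

definition code_length :: "nat \<Rightarrow> nat" where
  "code_length n = (LEAST i. code_drop n i = 0)"

lemma code_drop_list_encode: "i \<le> length xs \<Longrightarrow> code_drop (list_encode xs) i = list_encode (drop i xs)"
proof (induction i)
  case (Suc i)
  then have "drop i xs = xs ! i # drop (Suc i) xs" by (simp add: Cons_nth_drop_Suc)
  then show ?case using Suc by (simp add: code_drop_def)
qed (simp add: code_drop_def)

lemma code_nth_list_encode: "i < length xs \<Longrightarrow> code_nth (list_encode xs) i = xs ! i"
  unfolding code_nth_def by (simp add: code_drop_list_encode flip: Cons_nth_drop_Suc)

lemma list_encode_eq_0: "list_encode xs = 0 \<longleftrightarrow> xs = []"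
  by (cases xs) auto

lemma code_length_list_encode: "code_length (list_encode xs) = length xs"
  unfolding code_length_def
proof (rule Least_equality)
  fix i assume "code_drop (list_encode xs) i = 0"
  then show "length xs \<le> i"
    by (metis code_drop_list_encode drop_eq_Nil2 linear list_encode_eq_0)
qed (simp add: code_drop_list_encode)

lemma computable_code_drop:
  assumes "computable k a" "computable k b" shows "computable k (\<lambda>xs. code_drop (a xs) (b xs))"
  unfolding code_drop_def
  by (rule computable_rec_nat[OF assms(1) _ assms(2), of "\<lambda>xs. snd (prod_decode (xs ! 1 - 1))"])
    (auto intro!: computable_snd_prod_decode computable_diff computable_proj computable_const)

lemma computable_code_nth: "computable k a \<Longrightarrow> computable k b \<Longrightarrow> computable k (\<lambda>xs. code_nth (a xs) (b xs))"
  unfolding code_nth_def by (intro computable_fst_prod_decode computable_diff computable_code_drop computable_const)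

lemma computable_code_length:
  assumes "computable k a" shows "computable k (\<lambda>xs. code_length (a xs))"
proof -
  have "\<exists>i. code_drop n i = 0" for n
    using code_drop_list_encode[of "length (list_decode n)" "list_decode n"] by auto
  then have "computable 1 (\<lambda>xs. code_length (xs ! 0))"
    using computable_Least[of 1 "\<lambda>xs. code_drop (xs ! 1) (xs ! 0) = 0"] unfolding code_length_def
    by (simp add: recursive_rel_eq_0 computable_code_drop computable_proj)
  from computable_comp1[OF this assms] show ?thesis .
qed

text \<open>Several witnesses are packed into one as the code of a list.\<close>

lemma Sigma01_witnesses:
  assumes "recursive_rel (Suc k) R"
  shows "Sigma01 {n. \<exists>ms. length ms = k \<and> R (n # ms)}"
proof -
  let ?hs = "(\<lambda>xs. xs ! 0) # map (\<lambda>i xs. code_nth (xs ! 1) i) [0..<k]"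
  have "recursive_rel 2 (\<lambda>xs. R (map (\<lambda>h. h xs) ?hs))"
    by (rule recursive_rel_comp) (use assms in \<open>auto intro!: computable_code_nth computable_proj computable_const\<close>)
  then have "recursive_rel 2 (\<lambda>xs. R (xs ! 0 # map (code_nth (xs ! 1)) [0..<k]))"
    by (simp add: o_def)
  moreover have "map (code_nth (list_encode ms)) [0..<length ms] = ms" for ms
    by (rule nth_equalityI) (auto simp: code_nth_list_encode)
  then have "{n. \<exists>ms. length ms = k \<and> R (n # ms)} = {n. \<exists>m. R (n # map (code_nth m) [0..<k])}"
    by (auto intro: exI[of _ "map (code_nth _) [0..<k]"]) metis
  ultimately show ?thesis unfolding Sigma01_def
    by (intro exI[of _ "\<lambda>xs. R (xs ! 0 # map (code_nth (xs ! 1)) [0..<k])"]) simp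
qed

section \<open>Certificates\<close>

text \<open>A number is read as a space-time diagram, with a row of cells for each time.  Addressing the cell
  by a coded pair, rather than by row length and offset, makes the reading independent of the
  dimensions of the diagram.\<close>

definition cell :: "nat \<Rightarrow> nat \<Rightarrow> nat \<Rightarrow> nat" where
  "cell D t i = code_nth D (prod_encode (t, i))"

lemma computable_cell:
  "computable k a \<Longrightarrow> computable k b \<Longrightarrow> computable k c \<Longrightarrow>
    computable k (\<lambda>xs. cell (a xs) (b xs) (c xs))"
  unfolding cell_def by (intro computable_code_nth computable_prod_encode)

lemma ex_diagram: "\<exists>D. \<forall>t<T. \<forall>i<p. cell D t i = d t i"
proof -
  define B where "B = Suc (Max (prod_encode ` ({..<T} \<times> {..<p})))"
  define D where "D = list_encode (map (\<lambda>n. case_prod d (prod_decode n)) [0..<B])"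
  have "cell D t i = d t i" if "t < T" "i < p" for t i
  proof -
    have "prod_encode (t, i) < B" unfolding B_def less_Suc_eq_le by (rule Max_ge) (use that in auto)
    then show ?thesis by (simp add: cell_def D_def code_nth_list_encode)
  qed
  then show ?thesis by blast
qed

definition local_transitions :: "('a \<Rightarrow> nat) \<Rightarrow> nat \<Rightarrow> ('a list \<Rightarrow> 'a) \<Rightarrow> nat list set" where
  "local_transitions c l F = {map c u @ [c (F u)] | u. length u = l}"

lemma finite_local_transitions: "finite (local_transitions c l (F :: 'a::finite list \<Rightarrow> 'a))"
proof -
  have "local_transitions c l F = (\<lambda>u. map c u @ [c (F u)]) ` {u. set u \<subseteq> UNIV \<and> length u = l}"
    by (auto simp: local_transitions_def)
  then show ?thesis using finite_lists_length_eq[of "UNIV :: 'a set" l] by simp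
qed

text \<open>\<open>D\<close> shows one spatial period, of length \<open>p\<close>, of the configurations at the times \<open>0, \<dots>, T\<close>.
  The initial row starts with the word of length \<open>l\<close> coded by \<open>W\<close> (the blocking word), the word
  coded by \<open>n\<close> occurs at position \<open>k\<close> at time \<open>s\<close>, the rows \<open>s\<close> and \<open>T\<close> coincide, and every
  window of \<open>2 * r + 1\<close> cells, with its centre one time step later, is a transition from \<open>A\<close>.
  Positions are read modulo \<open>p\<close>.\<close>

definition certificate :: "nat list set \<Rightarrow> nat \<Rightarrow> nat \<Rightarrow> nat \<Rightarrow>
    nat \<Rightarrow> nat \<Rightarrow> nat \<Rightarrow> nat \<Rightarrow> nat \<Rightarrow> nat \<Rightarrow> bool" where
  "certificate A r l W n p k s T D \<longleftrightarrow>
    0 < p \<and> s < T \<and>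
    (\<forall>j<l. cell D 0 (j mod p) = code_nth W j) \<and>
    (\<forall>j<code_length n. cell D s ((k + j) mod p) = code_nth n j) \<and>
    (\<forall>i<p. cell D s i = cell D T i) \<and>
    (\<forall>t<T. \<forall>i<p. map (\<lambda>j. cell D t ((i + j) mod p)) [0..<2 * r + 1]
        @ [cell D (Suc t) ((i + r) mod p)] \<in> A)"

lemma recursive_certificate:
  assumes A: "finite A"
  shows "recursive_rel 6
    (\<lambda>xs. certificate A r l W (xs ! 0) (xs ! 1) (xs ! 2) (xs ! 3) (xs ! 4) (xs ! 5))"
  unfolding certificate_def
proof (intro recursive_rel_conj recursive_rel_less computable_const computable_proj)
  note computable_rules = computable_cell computable_code_nth computable_mod computable_add
    computable_Suc computable_const computable_proj computable_code_length
  show "recursive_rel 6 (\<lambda>xs. \<forall>j<l. cell (xs ! 5) 0 (j mod xs ! 1) = code_nth W j)"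
    by (rule recursive_rel_all_less[where
          R = "\<lambda>xs. cell (xs ! 6) 0 (xs ! 0 mod xs ! 2) = code_nth W (xs ! 0)"])
      (auto intro!: recursive_rel_eq computable_rules)
  show "recursive_rel 6 (\<lambda>xs. \<forall>j<code_length (xs ! 0).
      cell (xs ! 5) (xs ! 3) ((xs ! 2 + j) mod xs ! 1) = code_nth (xs ! 0) j)"
    by (rule recursive_rel_all_less[where
          R = "\<lambda>xs. cell (xs ! 6) (xs ! 4) ((xs ! 3 + xs ! 0) mod xs ! 2) = code_nth (xs ! 1) (xs ! 0)"])
      (auto intro!: recursive_rel_eq computable_rules)
  show "recursive_rel 6 (\<lambda>xs. \<forall>i<xs ! 1. cell (xs ! 5) (xs ! 3) i = cell (xs ! 5) (xs ! 4) i)"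
    by (rule recursive_rel_all_less[where
          R = "\<lambda>xs. cell (xs ! 6) (xs ! 4) (xs ! 0) = cell (xs ! 6) (xs ! 5) (xs ! 0)"])
      (auto intro!: recursive_rel_eq computable_rules)
  let ?R = "\<lambda>xs. map (\<lambda>j. cell (xs ! 7) (xs ! 1) ((xs ! 0 + j) mod xs ! 3)) [0..<2 * r + 1]
      @ [cell (xs ! 7) (Suc (xs ! 1)) ((xs ! 0 + r) mod xs ! 3)] \<in> A"
  let ?S = "\<lambda>xs. \<forall>i<xs ! 2. map (\<lambda>j. cell (xs ! 6) (xs ! 0) ((i + j) mod xs ! 2)) [0..<2 * r + 1]
      @ [cell (xs ! 6) (Suc (xs ! 0)) ((i + r) mod xs ! 2)] \<in> A"
  let ?hs = "map (\<lambda>j xs. cell (xs ! 7) (xs ! 1) ((xs ! 0 + j) mod xs ! 3)) [0..<2 * r + 1]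
      @ [\<lambda>xs. cell (xs ! 7) (Suc (xs ! 1)) ((xs ! 0 + r) mod xs ! 3)]"
  have "recursive_rel 8 (\<lambda>xs. map (\<lambda>h. h xs) ?hs \<in> A)"
    by (rule recursive_rel_list_mem[OF A]) (auto intro!: computable_rules)
  then have R: "recursive_rel 8 ?R" by (simp add: o_def)
  have S: "recursive_rel 7 ?S"
    by (rule recursive_rel_all_less[where R = ?R]) (use R in \<open>auto intro!: computable_rules\<close>)
  show "recursive_rel 6 (\<lambda>xs. \<forall>t<xs ! 4. \<forall>i<xs ! 1.
      map (\<lambda>j. cell (xs ! 5) t ((i + j) mod xs ! 1)) [0..<2 * r + 1]
        @ [cell (xs ! 5) (Suc t) ((i + r) mod xs ! 1)] \<in> A)"
    by (rule recursive_rel_all_less[where R = ?S]) (use S in \<open>auto intro!: computable_rules\<close>)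
qed auto

lemma Sigma01_certificate:
  assumes "finite A"
  shows "Sigma01 {n. \<exists>p k s T D. certificate A r l W n p k s T D}"
proof -
  let ?R = "\<lambda>xs. certificate A r l W (xs ! 0) (xs ! 1) (xs ! 2) (xs ! 3) (xs ! 4) (xs ! 5)"
  have "(\<exists>ms. length ms = 5 \<and> ?R (n # ms)) \<longleftrightarrow>
      (\<exists>p k s T D. certificate A r l W n p k s T D)" for n
  proof
    assume "\<exists>p k s T D. certificate A r l W n p k s T D"
    then obtain p k s T D where "certificate A r l W n p k s T D" by blast
    then show "\<exists>ms. length ms = 5 \<and> ?R (n # ms)" by (intro exI[of _ "[p, k, s, T, D]"]) simp
  qed (simp, blast)
  then show ?thesis
    using Sigma01_witnesses[of 5 ?R] recursive_certificate[OF assms, of r l W] by simp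
qed

context blocked_automaton
begin

lemma local_rule_window: "f y (i + int r) = F (map (\<lambda>j. y (i + int j)) [0..<2 * r + 1])"
proof -
  have "map y [i + int r - int r..i + int r + int r] = map (\<lambda>j. y (i + int j)) [0..<2 * r + 1]"
    by (rule nth_equalityI) (auto simp del: upt_Suc)
  then show ?thesis by (simp add: local_rule)
qed

text \<open>A diagram with these properties is the evolution of a configuration as in
  \<open>language_generic_limit_set_iff\<close>, and conversely.  Letters are recovered from their numbers
  without a separate condition: every row is read by some transition, the last one because it
  equals an earlier row.\<close>

lemma certificate_iff:
  assumes c: "inj c"
  defines "A \<equiv> local_transitions c (2 * r + 1) F"
    and "W \<equiv> word_code c (map x [- int m..int m])"
  shows "(\<exists>p k s T D. certificate A r (2 * m + 1) W n p k s T D) \<longleftrightarrow>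
    n \<in> word_code c ` language (generic_limit_set f)"
proof -
  have W: "code_nth W j = c (x (int j - int m))" if "j < 2 * m + 1" for j
    using that by (simp add: W_def word_code_def code_nth_list_encode)
  show ?thesis
  proof
    assume "n \<in> word_code c ` language (generic_limit_set f)"
    then obtain v where n: "n = word_code c v" and "v \<in> language (generic_limit_set f)" by blast
    then obtain z p k s T where p: "0 < p" and per: "\<And>i. z (i + int p) = z i"
      and block: "block_at z (int m)" and sT: "s < T" "(f ^^ s) z = (f ^^ T) z"
      and v: "word_at v (int k) ((f ^^ s) z)"
      unfolding language_generic_limit_set_iff by blast
    obtain D where D: "\<And>t i. t < Suc T \<Longrightarrow> i < p \<Longrightarrow> cell D t i = c ((f ^^ t) z (int i))"
      using ex_diagram[of "Suc T" p "\<lambda>t i. c ((f ^^ t) z (int i))"] by blast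
    have cell: "cell D t (a mod p) = c ((f ^^ t) z (int a))" if "t \<le> T" for t a
      using that p D[of t "a mod p"] periodic_mod[of "(f ^^ t) z" "int p" "int a", OF iterate_periodic[of z "int p", OF per]]
      by (simp add: zmod_int)
    have "certificate A r (2 * m + 1) W n p k s T D"
      unfolding certificate_def
    proof (intro conjI allI impI p sT(1))
      fix j assume j: "j < 2 * m + 1"
      have "int j - int m \<in> {- int m..int m}" using j by auto
      with block have "z (int m + (int j - int m)) = x (int j - int m)" unfolding block_at_def by blast
      then show "cell D 0 (j mod p) = code_nth W j" using W[OF j] cell[of 0 j] by simp
    next
      fix j assume "j < code_length n"
      then show "cell D s ((k + j) mod p) = code_nth n j"
        using sT(1) v by (simp add: n word_code_def code_length_list_encode code_nth_list_encode cell word_at_def)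
    next
      fix i assume "i < p"
      then show "cell D s i = cell D T i" using D[of s i] D[of T i] sT by simp
    next
      fix t i assume t: "t < T" and i: "i < p"
      define u where "u = map (\<lambda>j. (f ^^ t) z (int i + int j)) [0..<2 * r + 1]"
      have "map (\<lambda>j. cell D t ((i + j) mod p)) [0..<2 * r + 1] = map c u"
        using t by (simp add: cell u_def)
      moreover have "cell D (Suc t) ((i + r) mod p) = c (F u)"
        using t cell[of "Suc t" "i + r"] local_rule_window[of "(f ^^ t) z" "int i"] by (simp add: u_def)
      moreover have "length u = 2 * r + 1" by (simp add: u_def)
      ultimately show "map (\<lambda>j. cell D t ((i + j) mod p)) [0..<2 * r + 1]
          @ [cell D (Suc t) ((i + r) mod p)] \<in> A"
        unfolding A_def local_transitions_def by blast
    qed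
    then show "\<exists>p k s T D. certificate A r (2 * m + 1) W n p k s T D" by blast
  next
    assume "\<exists>p k s T D. certificate A r (2 * m + 1) W n p k s T D"
    then obtain p k s T D where p: "0 < p" and sT: "s < T"
      and block: "\<And>j. j < 2 * m + 1 \<Longrightarrow> cell D 0 (j mod p) = code_nth W j"
      and word: "\<And>j. j < code_length n \<Longrightarrow> cell D s ((k + j) mod p) = code_nth n j"
      and return: "\<And>i. i < p \<Longrightarrow> cell D s i = cell D T i"
      and trans: "\<And>t i. t < T \<Longrightarrow> i < p \<Longrightarrow> map (\<lambda>j. cell D t ((i + j) mod p)) [0..<2 * r + 1]
          @ [cell D (Suc t) ((i + r) mod p)] \<in> A"
      unfolding certificate_def by blast
    have window: "\<exists>u. map c u = map (\<lambda>j. cell D t ((i + j) mod p)) [0..<2 * r + 1] \<and>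
        c (F u) = cell D (Suc t) ((i + r) mod p)" if ti: "t < T" "i < p" for t i
    proof -
      obtain u where "map (\<lambda>j. cell D t ((i + j) mod p)) [0..<2 * r + 1]
          @ [cell D (Suc t) ((i + r) mod p)] = map c u @ [c (F u)]"
        using trans[OF ti] unfolding A_def local_transitions_def by blast
      then show ?thesis unfolding append1_eq_conv by metis
    qed
    have range_less: "cell D t i \<in> range c" if ti: "t < T" "i < p" for t i
    proof -
      obtain u where u: "map c u = map (\<lambda>j. cell D t ((i + j) mod p)) [0..<2 * r + 1]"
        using window[OF ti] by blast
      have "cell D t ((i + 0) mod p) \<in> set (map (\<lambda>j. cell D t ((i + j) mod p)) [0..<2 * r + 1])"
        unfolding set_map by (rule imageI) (simp del: upt_Suc)
      then show ?thesis unfolding u[symmetric] using ti by auto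
    qed
    have range: "cell D t i \<in> range c" if "t \<le> T" "i < p" for t i
      using range_less[of t i] range_less[of s i] return[of i] that sT by (cases "t = T") auto
    \<comment> \<open>The spatially periodic configurations drawn in \<open>D\<close>.\<close>
    define z where "z t i = inv c (cell D t (nat (i mod int p)))" for t and i :: int
    have c_z: "c (z t i) = cell D t (nat (i mod int p))" if "t \<le> T" for t i
      unfolding z_def by (intro f_inv_into_f range) (use that p in \<open>auto simp: nat_less_iff\<close>)
    have c_z_nat: "c (z t (int a)) = cell D t (a mod p)" if "t \<le> T" for t a
      using c_z[OF that, of "int a"] by (simp flip: zmod_int)
    have step: "f (z t) = z (Suc t)" if t: "t < T" for t
    proof
      fix i
      \<comment> \<open>The left end of the neighbourhood of \<open>i\<close>, moved into the period.\<close>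
      define i0 where "i0 = nat ((i - int r) mod int p)"
      have i0: "i0 < p" using p by (simp add: i0_def nat_less_iff)
      have shift: "(i0 + j) mod p = nat ((i - int r + int j) mod int p)" for j
      proof -
        have "int ((i0 + j) mod p) = (i - int r + int j) mod int p"
          using p by (simp add: zmod_int i0_def mod_add_left_eq)
        then show ?thesis by simp
      qed
      obtain u where u: "map c u = map (\<lambda>j. cell D t ((i0 + j) mod p)) [0..<2 * r + 1]"
        "c (F u) = cell D (Suc t) ((i0 + r) mod p)" using window[OF t i0] by blast
      have "map c u = map c (map (\<lambda>j. z t (i - int r + int j)) [0..<2 * r + 1])"
        unfolding u(1) using t by (simp add: c_z shift)
      then have "u = map (\<lambda>j. z t (i - int r + int j)) [0..<2 * r + 1]"
        using c by (simp only: inj_map_eq_map)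
      then have "f (z t) i = F u" using local_rule_window[of "z t" "i - int r"] by simp
      moreover have "c (F u) = c (z (Suc t) i)" unfolding u(2) shift using t by (simp add: c_z)
      ultimately show "f (z t) i = z (Suc t) i" using c by (simp add: inj_eq)
    qed
    have orbit: "(f ^^ t) (z 0) = z t" if "t \<le> T" for t
      using that by (induction t) (simp_all add: step)
    define v where "v = map (\<lambda>j. z s (int k + int j)) [0..<code_length n]"
    have "z 0 (i + int p) = z 0 i" for i by (simp add: z_def)
    moreover have "block_at (z 0) (int m)" unfolding block_at_def
    proof
      fix i assume i: "i \<in> {- int m..int m}"
      define j where "j = nat (int m + i)"
      have j: "int j = int m + i" "j < 2 * m + 1" using i by (auto simp: j_def)
      have "c (z 0 (int m + i)) = c (x i)"
        using c_z_nat[of 0 j] block[OF j(2)] W[OF j(2)] by (simp add: j(1))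
      then show "z 0 (int m + i) = x i" using c by (simp add: inj_eq)
    qed
    moreover have "(f ^^ s) (z 0) = (f ^^ T) (z 0)"
    proof -
      have "z s i = z T i" for i using return[of "nat (i mod int p)"] p by (simp add: z_def nat_less_iff)
      then show ?thesis using orbit[of s] orbit[of T] sT by auto
    qed
    moreover have "word_at v (int k) ((f ^^ s) (z 0))"
      using orbit[of s] sT by (simp add: word_at_def v_def)
    ultimately have "v \<in> language (generic_limit_set f)"
      unfolding language_generic_limit_set_iff using p sT by blast
    moreover have "word_code c v = n"
    proof -
      have "map c v = list_decode n"
      proof (rule nth_equalityI)
        show "length (map c v) = length (list_decode n)"
          using code_length_list_encode[of "list_decode n"] by (simp add: v_def)
        fix j assume j: "j < length (map c v)"
        then have j': "j < code_length n" by (simp add: v_def)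
        have "map c v ! j = c (z s (int (k + j)))" using j' by (simp add: v_def)
        also have "\<dots> = code_nth n j" using c_z_nat[of s "k + j"] sT word[OF j'] by simp
        also have "\<dots> = list_decode n ! j"
          using code_nth_list_encode[of j "list_decode n"] code_length_list_encode[of "list_decode n"] j' by simp
        finally show "map c v ! j = list_decode n ! j" .
      qed
      then show ?thesis by (simp add: word_code_def)
    qed
    ultimately show "n \<in> word_code c ` language (generic_limit_set f)" by blast
  qed
qed

end

theorem proposition4p9:
  fixes f :: "(int \<Rightarrow> 'a::finite) \<Rightarrow> (int \<Rightarrow> 'a)"
  assumes "cellular_automaton f"
    and "\<exists>x. equicontinuity_point f x"
  shows "Sigma01_language (language (generic_limit_set f))"
  unfolding Sigma01_language_def
proof (intro allI impI)
  fix c :: "'a \<Rightarrow> nat" assume "bij_betw c UNIV {..<CARD('a)}"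
  then have c: "inj c" by (rule bij_betw_imp_inj_on)
  obtain x where "equicontinuity_point f x" using assms(2) by blast
  then obtain F r m where f: "blocked_automaton f F r x m"
    using equicontinuity_point_imp_blocked_automaton[OF assms(1)] by blast
  show "Sigma01 (word_code c ` language (generic_limit_set f))"
    using Sigma01_certificate[OF finite_local_transitions, of c "2 * r + 1" F r "2 * m + 1"
        "word_code c (map x [- int m..int m])"]
    unfolding blocked_automaton.certificate_iff[OF f c] by simp
qed

end
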